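(* Let $A=\{a_n\}$ be an infinite set of natural numbers. If $\lim_{n\to\infty}\frac{a_n}{n^{3/2}}=0$, then there exists a sequence of shifts $\langle x_n\mid n\in\mathbb{N}\rangle$, $x_n\in\mathbb{N}$, such that $$\limsup_{n\to\infty}\left(\frac{\frac{|A\cap(A+x_n)\cap[1,n]|}{n}}{\left(\frac{|A\cap[1,n]|}{n}\right)^2}\right)\ \ge\ 1.$$
   Context: $\mathbb{N}$ is the set of positive integers (so every shift $x_n$ is at least $1$). Writing $A=\{a_n\}$ means that $a_1<a_2<\ldots$ is the increasing enumeration of the infinite set $A\subseteq\mathbb{N}$. $A+x=\{a+x\mid a\in A\}$. The quotient is considered for $n\ge a_1$, where its denominator is nonzero. *)

theory Defs
  imports "HOL-Analysis.Analysis"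
begin

definition shift :: "nat set \<Rightarrow> nat \<Rightarrow> nat set" where
  "shift A x = {a + x | a. a \<in> A}"

definition rel_density :: "nat set \<Rightarrow> nat \<Rightarrow> real" where
  "rel_density A n = real (card (A \<inter> {1..n})) / real n"

end

theory Submission
  imports Defs
begin

text \<open>
  Many translates of a set inside a slightly longer interval are forced to overlap, and the bound
  that Cauchy--Schwarz gives for the overlap is asymptotically sharp when the number of translates
  is small compared with the length of the interval.

  Write \<open>k = card (A \<inter> {1..n})\<close>, and let \<open>M\<close> be the largest value of
  \<open>card (A \<inter> shift A x \<inter> {1..n})\<close> over all \<open>x \<ge> 1\<close>; the shift \<open>x n\<close> is one
  that attains it. The \<open>H\<close> translates of \<open>A \<inter> {1..n}\<close> by \<open>0, \<dots>, H - 1\<close> lie in an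
  interval of length \<open>n + H\<close>. Each of them has \<open>k\<close> elements, and two distinct ones share at most \<open>M\<close>,
  because the intersection of the translates by \<open>i < j\<close> is a translate of the intersection
  of \<open>A \<inter> {1..n}\<close> with its own shift by \<open>j - i\<close>. The second moment inequality
  \<open>sum_card_squared_le\<close> then gives \<open>(H k)\<^sup>2 \<le> (n + H) (H k + H\<^sup>2 M)\<close>, that is,
  \<open>n M / k\<^sup>2 \<ge> n / (n + H) - n / (H k)\<close>.
  The right-hand side is close to \<open>1\<close> when \<open>n / k\<close> is small against \<open>H\<close> and \<open>H\<close> is small against
  \<open>n\<close>. The geometric mean \<open>H \<approx> n / sqrt k\<close> balances the two errors and yields
  the lower bound \<open>1 - 2 / sqrt k - 1 / n\<close>, which tends to \<open>1\<close> because \<open>A\<close> is infinite.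
\<close>

text \<open>
  Cauchy--Schwarz for the function that counts how many of the sets contain a given point:
  its sum over \<open>X\<close> is the left-hand side before squaring, and its sum of squares counts
  the points common to each ordered pair of sets.
\<close>
lemma sum_card_squared_le:
  fixes S :: "'i \<Rightarrow> 'a set"
  assumes "finite X" and sub: "\<And>i. i \<in> I \<Longrightarrow> S i \<subseteq> X"
  shows "(\<Sum>i\<in>I. real (card (S i)))\<^sup>2 \<le> real (card X) * (\<Sum>i\<in>I. \<Sum>j\<in>I. real (card (S i \<inter> S j)))"
proof -
  define w :: "'a \<Rightarrow> real" where "w m = (\<Sum>i\<in>I. indicator (S i) m)" for m
  have card_eq: "real (card T) = (\<Sum>m\<in>X. indicator T m)" if "T \<subseteq> X" for T
    using that sum_mult_indicator[OF \<open>finite X\<close>, of "\<lambda>_. 1::real" "\<lambda>_. T" "\<lambda>m. m"] by (simp add: Int_absorb1 flip: Int_def)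
  have "(\<Sum>i\<in>I. real (card (S i))) = (\<Sum>i\<in>I. \<Sum>m\<in>X. indicator (S i) m)"
    using card_eq sub by (intro sum.cong) auto
  also have "\<dots> = (\<Sum>m\<in>X. w m)"
    unfolding w_def by (rule sum.swap)
  finally have first: "(\<Sum>i\<in>I. real (card (S i))) = (\<Sum>m\<in>X. w m)" .
  have "(\<Sum>i\<in>I. \<Sum>j\<in>I. real (card (S i \<inter> S j)))
      = (\<Sum>i\<in>I. \<Sum>j\<in>I. \<Sum>m\<in>X. indicator (S i) m * indicator (S j) m)"
    using card_eq sub by (intro sum.cong refl) (simp add: le_infI1 flip: indicator_inter_arith)
  also have "\<dots> = (\<Sum>i\<in>I. \<Sum>m\<in>X. \<Sum>j\<in>I. indicator (S i) m * indicator (S j) m)"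
    by (intro sum.cong refl sum.swap)
  also have "\<dots> = (\<Sum>m\<in>X. \<Sum>i\<in>I. \<Sum>j\<in>I. indicator (S i) m * indicator (S j) m)"
    by (rule sum.swap)
  also have "\<dots> = (\<Sum>m\<in>X. (w m)\<^sup>2)"
    by (simp add: w_def power2_eq_square sum_product)
  finally have second: "(\<Sum>i\<in>I. \<Sum>j\<in>I. real (card (S i \<inter> S j))) = (\<Sum>m\<in>X. (w m)\<^sup>2)" .
  show ?thesis
    unfolding first second using sum_squared_le_sum_of_squares[of w X]
    by (simp add: mult.commute)
qed

lemma shift_eq_image: "shift A x = (\<lambda>a. a + x) ` A"
  by (auto simp: shift_def)

lemma card_shift: "card (shift A x) = card A"
  unfolding shift_eq_image by (rule card_image) simp

lemma card_shift_Int_shift: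
  assumes "i \<le> j"
  shows "card (shift B i \<inter> shift B j) = card (B \<inter> shift B (j - i))"
proof -
  have "shift B j = shift (shift B (j - i)) i"
    unfolding shift_eq_image image_image using assms by simp
  then have "shift B i \<inter> shift B j = shift (B \<inter> shift B (j - i)) i"
    unfolding shift_eq_image by (simp add: image_Int)
  then show ?thesis
    by (simp add: card_shift)
qed

lemma self_intersection_lower_bound:
  fixes B :: "nat set"
  assumes B: "B \<subseteq> {1..n}" and M: "\<And>x. x \<ge> 1 \<Longrightarrow> card (B \<inter> shift B x) \<le> M" and "H > 0"
  shows "real H * (real (card B))\<^sup>2 \<le> real (n + H) * (real (card B) + real H * real M)"
proof -
  define k where "k = card B"
  have "shift B i \<subseteq> {1..n + H}" if "i \<in> {..<H}" for i
    using that B by (fastforce simp: shift_def)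
  then have "(\<Sum>i<H. real (card (shift B i)))\<^sup>2
      \<le> real (card {1..n + H}) * (\<Sum>i<H. \<Sum>j<H. real (card (shift B i \<inter> shift B j)))"
    by (intro sum_card_squared_le) auto
  then have "(real H * real k)\<^sup>2
      \<le> real (n + H) * (\<Sum>i<H. \<Sum>j<H. real (card (shift B i \<inter> shift B j)))"
    by (simp add: card_shift k_def)
  also have "\<dots> \<le> real (n + H) * (\<Sum>i<H. \<Sum>j<H. (if j = i then real k else 0) + real M)"
  proof (intro mult_left_mono sum_mono)
    fix i j :: nat
    consider "i = j" | "i < j" | "j < i"
      by linarith
    then show "real (card (shift B i \<inter> shift B j)) \<le> (if j = i then real k else 0) + real M"
    proof cases
      case 1
      then show ?thesis by (simp add: card_shift k_def)
    next
      case 2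
      then show ?thesis using M[of "j - i"] by (simp add: card_shift_Int_shift)
    next
      case 3
      then show ?thesis using M[of "i - j"]
        by (simp add: card_shift_Int_shift Int_commute[of "shift B i" "shift B j"])
    qed
  qed simp
  also have "\<dots> = real (n + H) * (real H * (real k + real H * real M))"
    by (simp add: sum.distrib distrib_left)
  finally have "real H * (real H * (real k)\<^sup>2) \<le> real H * (real (n + H) * (real k + real H * real M))"
    by (simp add: power2_eq_square mult_ac)
  then show ?thesis
    using \<open>H > 0\<close> by (simp add: k_def)
qed

text \<open>
  The choice of \<open>H\<close> near \<open>n / sqrt k\<close> turns the previous bound into an explicit one;
  the summand \<open>1 / n\<close> pays for rounding \<open>H\<close> up to an integer.
\<close>
lemma max_self_intersection_ratio:
  fixes B :: "nat set"
  assumes B: "B \<subseteq> {1..n}" and M: "\<And>x. x \<ge> 1 \<Longrightarrow> card (B \<inter> shift B x) \<le> M" and "B \<noteq> {}"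
  shows "1 - 2 / sqrt (real (card B)) - 1 / real n \<le> real n * real M / (real (card B))\<^sup>2"
proof -
  define k where "k = real (card B)"
  define H where "H = nat \<lceil>real n / sqrt k\<rceil>"
  have n: "real n > 0"
    using B \<open>B \<noteq> {}\<close> by (cases n) auto
  have k: "k > 0"
    using B \<open>B \<noteq> {}\<close> finite_subset[OF B] by (simp add: k_def card_gt_0_iff)
  have Hlow: "real n / sqrt k \<le> real H" and Hup: "real H \<le> real n / sqrt k + 1"
    using n k unfolding H_def by (simp_all add: real_nat_ceiling_ge)
  have H: "real H > 0"
    using Hlow n k by (smt (verit) divide_pos_pos real_sqrt_gt_zero)
  have "real H * k\<^sup>2 \<le> (real n + real H) * (k + real H * real M)"
    using self_intersection_lower_bound[OF B M, of H] H by (simp add: k_def)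
  then have "real n / (real n + real H) \<le> real n * (k + real H * real M) / (real H * k\<^sup>2)"
    using n k H by (simp add: divide_simps mult_ac)
  also have "\<dots> = real n / real H / k + real n * real M / k\<^sup>2"
    using k H by (simp add: field_simps power2_eq_square)
  also have "real n / real H / k \<le> sqrt k / k"
    using Hlow n k H by (intro divide_right_mono) (simp_all add: field_simps)
  also have "sqrt k / k = 1 / sqrt k"
    using k by (simp add: real_div_sqrt divide_simps)
  finally have upper: "real n / (real n + real H) \<le> 1 / sqrt k + real n * real M / k\<^sup>2"
    by simp
  have "1 - 1 / sqrt k - 1 / real n = 1 - (real n / sqrt k + 1) / real n"
    using n by (simp add: field_simps)
  also have "\<dots> \<le> 1 - real H / real n"
    using Hup n by (simp add: divide_right_mono)
  also have "\<dots> \<le> 1 - real H / (real n + real H)"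
    using n H by (simp add: frac_le)
  also have "\<dots> = real n / (real n + real H)"
    using n H by (simp add: field_simps)
  finally show ?thesis
    using upper by (simp add: k_def)
qed

lemma card_Int_atMost_at_top:
  fixes A :: "nat set"
  assumes "infinite A"
  shows "filterlim (\<lambda>n. card (A \<inter> {1..n})) at_top sequentially"
  unfolding filterlim_at_top eventually_sequentially
proof
  fix Z
  have "infinite (A - {0})"
    using assms by simp
  then obtain F where F: "F \<subseteq> A - {0}" "finite F" "card F = Z"
    using infinite_arbitrarily_large by blast
  have "Z \<le> card (A \<inter> {1..n})" if "n \<ge> Max F" for n
  proof -
    have "F \<subseteq> A \<inter> {1..n}"
    proof
      fix y assume "y \<in> F"
      then show "y \<in> A \<inter> {1..n}"
        using F(1) that Max_ge[OF F(2) \<open>y \<in> F\<close>] by auto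
    qed
    then show ?thesis
      using F(3) card_mono[of "A \<inter> {1..n}" F] by simp
  qed
  then show "\<exists>N. \<forall>n\<ge>N. Z \<le> card (A \<inter> {1..n})"
    by blast
qed

theorem corollary4p2:
  fixes A :: "nat set" and a :: "nat \<Rightarrow> nat"
  assumes "infinite A" and "A \<subseteq> {1..}"
    and "strict_mono_on {1..} a" and "A = a ` {1..}"
    and "(\<lambda>n. real (a n) / real n powr (3 / 2)) \<longlonglongrightarrow> 0"
  shows "\<exists>x :: nat \<Rightarrow> nat. (\<forall>n\<ge>1. x n \<ge> 1) \<and>
    limsup (\<lambda>n. ereal (rel_density (A \<inter> shift A (x n)) n / (rel_density A n)\<^sup>2)) \<ge> 1"
proof -
  define r where "r n x = card (A \<inter> shift A x \<inter> {1..n})" for n x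
  have "\<exists>x\<ge>1. \<forall>y\<ge>1. r n y \<le> r n x" for n
  proof (rule ex_has_greatest_nat[of "\<lambda>x. x \<ge> 1" 1 "r n" "Suc n"])
    have "card (A \<inter> shift A y \<inter> {1..n}) \<le> card {1..n}" for y
      by (intro card_mono) auto
    then show "\<forall>y\<ge>1. r n y < Suc n"
      by (simp add: r_def less_Suc_eq_le)
  qed simp
  then obtain x where x: "\<And>n. x n \<ge> 1" and max: "\<And>n y. y \<ge> 1 \<Longrightarrow> r n y \<le> r n (x n)"
    by metis
  define k where "k n = card (A \<inter> {1..n})" for n
  define q where "q n = rel_density (A \<inter> shift A (x n)) n / (rel_density A n)\<^sup>2" for n
  define lower where "lower n = 1 - 2 / sqrt (real (k n)) - 1 / real n" for n
  have k_lim: "filterlim k at_top sequentially"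
    unfolding k_def using assms(1) by (rule card_Int_atMost_at_top)
  have "eventually (\<lambda>n. lower n \<le> q n) sequentially"
  proof -
    have "eventually (\<lambda>n. k n \<ge> 1) sequentially"
      using k_lim by (simp add: filterlim_at_top)
    then show ?thesis
    proof eventually_elim
      case (elim n)
      define B where "B = A \<inter> {1..n}"
      have "B \<noteq> {}"
        using elim by (auto simp: B_def k_def)
      have M: "card (B \<inter> shift B y) \<le> r n (x n)" if "y \<ge> 1" for y
      proof -
        have "card (B \<inter> shift B y) \<le> r n y"
          unfolding r_def B_def by (intro card_mono) (auto simp: shift_def)
        then show ?thesis
          using max[OF that, of n] by linarith
      qed
      have "lower n \<le> real n * real (r n (x n)) / (real (k n))\<^sup>2"
        using max_self_intersection_ratio[of B n "r n (x n)"] M \<open>B \<noteq> {}\<close>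
        by (simp add: B_def lower_def k_def)
      also have "\<dots> = q n"
        using elim
        by (simp add: q_def rel_density_def r_def k_def power2_eq_square)
      finally show ?case .
    qed
  qed
  then have ev: "eventually (\<lambda>n. ereal (lower n) \<le> ereal (q n)) sequentially"
    by simp
  have "lower \<longlonglongrightarrow> 1 - 0 - 0"
    unfolding lower_def
  proof (intro tendsto_diff tendsto_const)
    have "filterlim (\<lambda>n. sqrt (real (k n))) at_top sequentially"
      using k_lim by (intro filterlim_compose[OF sqrt_at_top]
          filterlim_compose[OF filterlim_real_sequentially])
    then show "(\<lambda>n. 2 / sqrt (real (k n))) \<longlonglongrightarrow> 0"
      by (intro tendsto_divide_0[OF tendsto_const] filterlim_at_top_imp_at_infinity)
    show "(\<lambda>n. 1 / real n) \<longlonglongrightarrow> 0"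
      by (rule lim_1_over_n)
  qed
  then have "(\<lambda>n. ereal (lower n)) \<longlonglongrightarrow> 1"
    by (simp add: one_ereal_def)
  then have "limsup (\<lambda>n. ereal (lower n)) = 1"
    by (intro lim_imp_Limsup) simp_all
  then have "1 \<le> limsup (\<lambda>n. ereal (q n))"
    using Limsup_mono[OF ev] by simp
  then show ?thesis
    using x unfolding q_def by blast
qed

end
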